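(* For every nonnegative integer $k$, \begin{align*} \mu(\underbrace{1+x,\ldots,1+x}_{k},\,1+x+y+z) &= -\frac{1}{\pi^2}\mathrm{Ls}^{(1)}_{k+3}(\pi) + \frac{1}{\pi^2}\int_0^\pi \mathrm{Ls}_2(\theta)\log^k\left(2\sin\frac{\theta}{2}\right)\mathrm{d}\theta\\ &= -\frac{1}{\pi^2}\mathrm{Ls}^{(1)}_{k+3}(\pi) - \frac{1}{\pi^2}\int_0^\pi \mathrm{Ls}_{k+1}(\theta)\log\left(2\sin\frac{\theta}{2}\right)\mathrm{d}\theta, \end{align*} where the left-hand side is the multiple Mahler measure of the $k+1$ listed polynomials in the three variables $x,y,z$.
   Context: For functions $P_1,\ldots,P_m$ of $n$ variables, the multiple Mahler measure is \[ \mu(P_1,\ldots,P_m) := \int_0^1\cdots\int_0^1 \prod_{j=1}^m \log\left|P_j\left(e^{2\pi i t_1},\ldots,e^{2\pi i t_n}\right)\right|\,\mathrm{d}t_1\cdots\mathrm{d}t_n . \] For integers $n\ge1$, $0\le j\le n-1$ and real $\sigma$: $\mathrm{Ls}_n(\sigma) := -\int_0^{\sigma}\log^{n-1}\left|2\sin\frac{\theta}{2}\right|\mathrm{d}\theta$ and the generalized log-sine integral $\mathrm{Ls}^{(j)}_n(\sigma) := -\int_0^{\sigma}\theta^j\log^{n-1-j}\left|2\sin\frac{\theta}{2}\right|\mathrm{d}\theta$. *)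

theory Defs
  imports "HOL-Analysis.Analysis" "HOL-Probability.Probability"
begin

definition multi_mahler :: "nat \<Rightarrow> ((nat \<Rightarrow> complex) \<Rightarrow> complex) list \<Rightarrow> real" where
  "multi_mahler n Ps =
     (\<integral>t. (\<Prod>P\<leftarrow>Ps. ln (cmod (P (\<lambda>j. cis (2 * pi * t j)))))
        \<partial>(PiM {..<n} (\<lambda>_. restrict_space lborel {0..1::real})))"

definition Ls :: "nat \<Rightarrow> real \<Rightarrow> real" where
  "Ls n \<sigma> = - (LBINT \<theta>=0..\<sigma>. (ln \<bar>2 * sin (\<theta> / 2)\<bar>) ^ (n - 1))"

definition Ls_gen :: "nat \<Rightarrow> nat \<Rightarrow> real \<Rightarrow> real" where
  "Ls_gen n j \<sigma> = - (LBINT \<theta>=0..\<sigma>. \<theta> ^ j * (ln \<bar>2 * sin (\<theta> / 2)\<bar>) ^ (n - 1 - j))"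

end

theory Submission
  imports Defs "HOL-Complex_Analysis.Cauchy_Integral_Formula"
begin

text \<open>
  Write $y + z = y (1 + w)$ with $w = z / y$; by rotation invariance $(x, w, y)$ is again uniform on
  the torus. Jensen's formula $\int \log |a + b y| = \log \max(|a|, |b|)$ eliminates $y$ and leaves
  the integral of $\log^k |1+x| \cdot \log \max(|1+x|, |1+w|)$. For uniform $x$ the length $|1+x|$ is
  distributed like $2 \sin (\theta / 2)$ with $\theta$ uniform on $[0, \pi]$, an increasing function
  of $\theta$, so the maximum is decided by comparing two angles. Over $\omega \le \theta$ the
  integral is the generalized log-sine term; over $\theta < \omega$ the two orders of integration
  give the two formulas, the first one using $\mathrm{Ls}_2(\pi) = 0$.
\<close>

subsection \<open>The uniform measure on the circle\<close>

text \<open>The Bochner integral of a non-integrable function is 0, so Fubini needs absolute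
  integrability, although the integrand has logarithmic singularities where \<open>1 + x\<close> or
  the last polynomial vanishes. For the innermost variable Jensen's formula itself supplies the
  bound: the L1 norm of a function that is bounded above is controlled by that bound and its
  integral, and Jensen computes the integral. What remains are powers of log |1+x| and log |1+w|,
  integrable by comparison with \<theta>^(-1/2). The changes of variables are stated as equalities
  of measures and proved with nonnegative integrals, so they apply to signed integrands before
  integrability is known. The value Ls_2(\<pi>) = 0 is Jensen's formula in the boundary case 1 + z,
  seen through the distribution of chord lengths.\<close>

definition circle_measure :: "complex measure" where
  "circle_measure = distr (restrict_space lborel {0..1::real}) borel (\<lambda>t. cis (2 * pi * t))"

lemma prob_space_unit_interval: "prob_space (restrict_space lborel {0..1::real})"
  by (rule prob_spaceI) (simp add: emeasure_restrict_space space_restrict_space)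

lemma measurable_cis [measurable]: "cis \<in> borel_measurable borel"
  by (intro borel_measurable_continuous_onI continuous_intros)

lemma measurable_circle [measurable]:
  "(\<lambda>t. cis (2 * pi * t)) \<in> borel_measurable (restrict_space lborel {0..1::real})"
  by (rule measurable_restrict_space1) measurable

interpretation circle: prob_space circle_measure
  unfolding circle_measure_def
  by (rule prob_space.prob_space_distr[OF prob_space_unit_interval]) measurable

interpretation circle2: pair_prob_space circle_measure circle_measure ..

interpretation circle3: pair_prob_space "circle_measure \<Otimes>\<^sub>M circle_measure" circle_measure ..

lemma sets_circle_measure [measurable_cong, simp]: "sets circle_measure = sets borel"
  by (simp add: circle_measure_def)

lemma space_circle_measure [simp]: "space circle_measure = UNIV"
  by (simp add: circle_measure_def)

text \<open>The half-open interval lets later proofs cut the period into disjoint pieces and shift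
  them without overlaps at the endpoints.\<close>

lemma nn_integral_circle_measure:
  assumes [measurable]: "h \<in> borel_measurable borel"
  shows "(\<integral>\<^sup>+z. h z \<partial>circle_measure)
       = (\<integral>\<^sup>+t. h (cis (2 * pi * t)) * indicator {0..<1} t \<partial>lborel)"
proof -
  have "(\<integral>\<^sup>+z. h z \<partial>circle_measure)
      = (\<integral>\<^sup>+t. h (cis (2 * pi * t)) * indicator {0..1} t \<partial>lborel)"
    unfolding circle_measure_def
    by (subst nn_integral_distr) (auto simp: nn_integral_restrict_space)
  also have "\<dots> = (\<integral>\<^sup>+t. h (cis (2 * pi * t)) * indicator {0..<1} t \<partial>lborel)"
    by (rule nn_integral_cong_AE, rule AE_mp[OF AE_lborel_singleton[of 1]])
       (auto simp: indicator_def)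
  finally show ?thesis .
qed

text \<open>Rotation is translation of a function of period 1. The part of the shifted window
  \<open>{u..<1 + u}\<close> that lies beyond 1 is moved back by one period and fills
  \<open>{0..<u}\<close>.\<close>

lemma nn_integral_circle_rotate:
  assumes [measurable]: "h \<in> borel_measurable borel" and "cmod w = 1"
  shows "(\<integral>\<^sup>+z. h (w * z) \<partial>circle_measure) = (\<integral>\<^sup>+z. h z \<partial>circle_measure)"
proof -
  \<comment> \<open>\<open>Arg\<close> may be negative; the fractional part is a shift in [0, 1),
    and periodicity absorbs the integer part.\<close>
  define u where "u = frac (Arg w / (2 * pi))"
  have u: "0 \<le> u" "u < 1" by (auto simp: u_def frac_lt_1)
  define g where "g = (\<lambda>t. h (cis (2 * pi * t)))"
  have [measurable]: "g \<in> borel_measurable borel" unfolding g_def by measurable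
  have per: "g (t + of_int k) = g t" for t k
  proof -
    have "cis (2 * pi * (t + of_int k)) = cis (2 * pi * t) * cis (2 * pi * of_int k)"
      by (simp add: distrib_left flip: cis_mult)
    also have "\<dots> = cis (2 * pi * t)" by (subst cis_multiple_2pi) auto
    finally show ?thesis by (simp only: g_def)
  qed
  define a where "a = Arg w / (2 * pi)"
  have "w = cis (2 * pi * a)"
    using assms(2) rcis_cmod_Arg[of w] by (simp add: rcis_def a_def)
  then have "w * cis (2 * pi * t) = cis (2 * pi * (t + a))" for t
    by (simp add: cis_mult algebra_simps)
  moreover have "t + u + of_int \<lfloor>a\<rfloor> = t + a" for t
    by (simp add: u_def frac_def flip: a_def)
  ultimately have "h (w * cis (2 * pi * t)) = g (t + u + of_int \<lfloor>a\<rfloor>)" for t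
    by (simp only: g_def)
  then have w: "h (w * cis (2 * pi * t)) = g (t + u)" for t
    by (simp only: per)
  have "(\<integral>\<^sup>+z. h (w * z) \<partial>circle_measure) = (\<integral>\<^sup>+t. g (t + u) * indicator {0..<1} t \<partial>lborel)"
    by (subst nn_integral_circle_measure) (auto simp: w)
  also have "\<dots> = (\<integral>\<^sup>+t. g t * indicator {u..<1 + u} t \<partial>lborel)"
    by (subst nn_integral_real_affine[of "\<lambda>t. g t * indicator {u..<1 + u} t" 1 u])
       (auto intro!: nn_integral_cong simp: indicator_def add.commute[of u])
  also have "\<dots> = (\<integral>\<^sup>+t. g t * indicator {u..<1} t + g t * indicator {1..<1 + u} t \<partial>lborel)"
    using u by (intro nn_integral_cong) (auto simp: indicator_def)
  also have "\<dots> = (\<integral>\<^sup>+t. g t * indicator {u..<1} t \<partial>lborel) + (\<integral>\<^sup>+t. g t * indicator {1..<1 + u} t \<partial>lborel)"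
    by (rule nn_integral_add) auto
  also have "(\<integral>\<^sup>+t. g t * indicator {1..<1 + u} t \<partial>lborel) = (\<integral>\<^sup>+t. g t * indicator {0..<u} t \<partial>lborel)"
    using per[of _ 1]
    by (subst nn_integral_real_affine[of "\<lambda>t. g t * indicator {1..<1 + u} t" 1 1])
       (auto intro!: nn_integral_cong simp: indicator_def add.commute[of 1])
  also have "(\<integral>\<^sup>+t. g t * indicator {u..<1} t \<partial>lborel) + \<dots>
           = (\<integral>\<^sup>+t. g t * indicator {u..<1} t + g t * indicator {0..<u} t \<partial>lborel)"
    by (rule nn_integral_add[symmetric]) auto
  also have "\<dots> = (\<integral>\<^sup>+t. g t * indicator {0..<1} t \<partial>lborel)"
    using u by (intro nn_integral_cong) (auto simp: indicator_def)
  also have "\<dots> = (\<integral>\<^sup>+z. h z \<partial>circle_measure)"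
    by (subst nn_integral_circle_measure) (auto simp: g_def)
  finally show ?thesis .
qed

lemma distr_circle_rotate:
  assumes "cmod w = 1"
  shows "distr circle_measure borel (\<lambda>z. w * z) = circle_measure"
proof (rule measure_eqI)
  fix A assume "A \<in> sets (distr circle_measure borel (\<lambda>z. w * z))"
  then have A [measurable]: "A \<in> sets borel" by simp
  have "emeasure (distr circle_measure borel (\<lambda>z. w * z)) A
      = (\<integral>\<^sup>+z. indicator A z \<partial>distr circle_measure borel (\<lambda>z. w * z))" by simp
  also have "\<dots> = (\<integral>\<^sup>+z. indicator A (w * z) \<partial>circle_measure)"
    by (rule nn_integral_distr) measurable
  also have "\<dots> = (\<integral>\<^sup>+z. indicator A z \<partial>circle_measure)"
    using assms by (intro nn_integral_circle_rotate) auto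
  finally show "emeasure (distr circle_measure borel (\<lambda>z. w * z)) A = emeasure circle_measure A"
    by simp
qed simp

text \<open>For fixed second coordinate y, division by y is a rotation of the third coordinate and
  preserves the circle measure. The coordinates are also reordered so that y comes last, ready to be
  integrated out first.\<close>

lemma distr_torus_shear:
  "distr (PiM {..<3::nat} (\<lambda>_. restrict_space lborel {0..1::real}))
     ((circle_measure \<Otimes>\<^sub>M circle_measure) \<Otimes>\<^sub>M circle_measure)
     (\<lambda>t. ((cis (2 * pi * t 0), cis (2 * pi * t 2) / cis (2 * pi * t 1)), cis (2 * pi * t 1)))
   = (circle_measure \<Otimes>\<^sub>M circle_measure) \<Otimes>\<^sub>M circle_measure"
  (is "distr ?P ?C ?T = _")
proof (rule measure_eqI)
  define M where "M = restrict_space lborel {0..1::real}"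
  interpret M: prob_space M unfolding M_def by (rule prob_space_unit_interval)
  interpret product_sigma_finite "\<lambda>_::nat. M" ..
  define e where "e = (\<lambda>t. cis (2 * pi * t))"
  have [measurable]: "e \<in> borel_measurable M" unfolding e_def M_def by measurable
  have C: "circle_measure = distr M borel e" by (simp add: circle_measure_def e_def M_def)
  have CM: "(\<integral>\<^sup>+z. f z \<partial>circle_measure) = (\<integral>\<^sup>+t. f (e t) \<partial>M)"
    if "f \<in> borel_measurable borel" for f
    using that by (simp add: C nn_integral_distr)
  have ne: "e t \<noteq> 0" "cmod (e t) = 1" for t by (simp_all add: e_def)
  \<comment> \<open>The product over three indices is taken apart as one factor times a
    pair.\<close>
  have Id: "{..<3::nat} = insert 0 {1, 2}" by auto
  fix A assume "A \<in> sets (distr ?P ?C ?T)"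
  then have A [measurable]: "A \<in> sets ?C" by simp
  have A' [measurable]: "A \<in> sets ((borel \<Otimes>\<^sub>M borel) \<Otimes>\<^sub>M borel)"
    using A by (simp cong: sets_pair_measure_cong)
  define h :: "complex \<Rightarrow> complex \<Rightarrow> complex \<Rightarrow> ennreal"
    where "h = (\<lambda>x w y. indicator A ((x, w), y))"
  have h [measurable]: "(\<lambda>p. h (f p) (g p) (k p)) \<in> borel_measurable N"
    if [measurable]: "f \<in> borel_measurable N" "g \<in> borel_measurable N" "k \<in> borel_measurable N"
    for f g k and N :: "'z measure" unfolding h_def by measurable
  have T: "?T = (\<lambda>t. ((e (t 0), e (t 2) / e (t 1)), e (t 1)))" by (simp add: e_def)
  have PT [measurable]: "?T \<in> measurable (PiM {..<3::nat} (\<lambda>_. M)) ?C"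
    unfolding T by measurable
  have "emeasure (distr ?P ?C ?T) A = (\<integral>\<^sup>+p. indicator A p \<partial>distr ?P ?C ?T)" by simp
  also have "\<dots> = (\<integral>\<^sup>+t. indicator A (?T t) \<partial>?P)"
    using PT by (intro nn_integral_distr) (auto simp: M_def)
  also have "\<dots> = (\<integral>\<^sup>+t. h (e (t 0)) (e (t 2) / e (t 1)) (e (t 1)) \<partial>PiM (insert (0::nat) {1,2}) (\<lambda>_. M))"
    unfolding Id[symmetric] M_def h_def e_def ..
  also have "\<dots> = (\<integral>\<^sup>+s. (\<integral>\<^sup>+t. h (e s) (e (t 2) / e (t 1)) (e (t 1)) \<partial>PiM {1,2::nat} (\<lambda>_. M)) \<partial>M)"
    by (subst product_nn_integral_insert_rev) auto
  also have "\<dots> = (\<integral>\<^sup>+s. (\<integral>\<^sup>+p. h (e s) (e (snd p) / e (fst p)) (e (fst p)) \<partial>(M \<Otimes>\<^sub>M M)) \<partial>M)"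
    by (intro nn_integral_cong product_nn_integral_pair) auto
  also have "\<dots> = (\<integral>\<^sup>+s. (\<integral>\<^sup>+t. (\<integral>\<^sup>+r. h (e s) (e r / e t) (e t) \<partial>M) \<partial>M) \<partial>M)"
    by (intro nn_integral_cong, subst M.nn_integral_fst[symmetric]) auto
  also have "\<dots> = (\<integral>\<^sup>+s. (\<integral>\<^sup>+t. (\<integral>\<^sup>+z. h (e s) (z / e t) (e t) \<partial>circle_measure) \<partial>M) \<partial>M)"
    by (rule nn_integral_cong, rule nn_integral_cong, rule sym, rule CM) measurable
  also have "\<dots> = (\<integral>\<^sup>+s. (\<integral>\<^sup>+t. (\<integral>\<^sup>+z. h (e s) z (e t) \<partial>circle_measure) \<partial>M) \<partial>M)"
  proof (rule nn_integral_cong, rule nn_integral_cong)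
    fix s t
    show "(\<integral>\<^sup>+z. h (e s) (z / e t) (e t) \<partial>circle_measure)
        = (\<integral>\<^sup>+z. h (e s) z (e t) \<partial>circle_measure)"
      using nn_integral_circle_rotate[of "\<lambda>z. h (e s) z (e t)" "inverse (e t)"] ne[of t]
      by (simp add: divide_inverse norm_inverse mult.commute)
  qed
  also have "\<dots> = (\<integral>\<^sup>+s. (\<integral>\<^sup>+y. (\<integral>\<^sup>+z. h (e s) z y \<partial>circle_measure) \<partial>circle_measure) \<partial>M)"
    by (rule nn_integral_cong, rule sym, rule CM) measurable
  also have "\<dots> = (\<integral>\<^sup>+x. (\<integral>\<^sup>+y. (\<integral>\<^sup>+z. h x z y \<partial>circle_measure) \<partial>circle_measure) \<partial>circle_measure)"
    by (rule sym, rule CM) measurable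
  \<comment> \<open>Once \<open>z\<close> no longer depends on \<open>y\<close>, the two can be
    exchanged.\<close>
  also have "\<dots> = (\<integral>\<^sup>+x. (\<integral>\<^sup>+z. (\<integral>\<^sup>+y. h x z y \<partial>circle_measure) \<partial>circle_measure) \<partial>circle_measure)"
    by (rule nn_integral_cong, rule circle2.Fubini') measurable
  also have "\<dots> = (\<integral>\<^sup>+p. (\<integral>\<^sup>+y. h (fst p) (snd p) y \<partial>circle_measure) \<partial>(circle_measure \<Otimes>\<^sub>M circle_measure))"
    by (subst circle.nn_integral_fst[symmetric]) auto
  also have "\<dots> = (\<integral>\<^sup>+p. indicator A p \<partial>?C)"
    by (subst circle.nn_integral_fst[symmetric]) (auto simp: h_def)
  finally show "emeasure (distr ?P ?C ?T) A = emeasure ?C A" by simp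
qed simp

lemma integral_circle_measure:
  fixes f :: "complex \<Rightarrow> real"
  assumes [measurable]: "f \<in> borel_measurable borel"
  shows "(\<integral>z. f z \<partial>circle_measure) = (LINT t:{0..1}|lborel. f (cis (2 * pi * t)))"
  unfolding circle_measure_def set_lebesgue_integral_def
  by (subst integral_distr) (auto simp: integral_restrict_space)

lemma AE_circle_measure_norm: "AE z in circle_measure. cmod z = 1"
  unfolding circle_measure_def by (subst AE_distr_iff) auto

subsection \<open>Chord lengths\<close>

text \<open>A density on the whole line keeps the sigma-algebra equal to \<open>borel\<close>, so
  plain Borel measurability suffices; the restriction to [0, \<pi>] enters only through the
  density.\<close>

definition half_circle_measure :: "real measure" where
  "half_circle_measure = density lborel (\<lambda>\<theta>. ennreal (indicator {0..pi} \<theta> / pi))"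

lemma sets_half_circle_measure [measurable_cong, simp]: "sets half_circle_measure = sets borel"
  and space_half_circle_measure [simp]: "space half_circle_measure = UNIV"
  by (simp_all add: half_circle_measure_def)

lemma nn_integral_half_circle_measure:
  assumes [measurable]: "h \<in> borel_measurable borel"
  shows "(\<integral>\<^sup>+\<theta>. h \<theta> \<partial>half_circle_measure)
       = (\<integral>\<^sup>+\<theta>. ennreal (1 / pi) * (h \<theta> * indicator {0..pi} \<theta>) \<partial>lborel)"
  unfolding half_circle_measure_def
  by (subst nn_integral_density) (auto intro!: nn_integral_cong simp: indicator_def)

lemma cmod_one_plus_cis: "cmod (1 + cis (2 * a)) = 2 * \<bar>cos a\<bar>"
proof -
  have "1 + cis (2 * a) = of_real (2 * cos a) * cis a"
    by (simp add: complex_eq_iff cos_double_cos sin_double power2_eq_square)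
  then show ?thesis by (simp add: norm_mult del: of_real_mult)
qed

text \<open>Here \<theta> is the angular distance of z from -1. The substitutions t = 1/2 -
  \<theta>/(2\<pi>) and t = 1/2 + \<theta>/(2\<pi>) map [0, \<pi>] onto the two halves of the period
  and turn 2|cos(\<pi>t)| into 2 sin(\<theta>/2). Each half contributes the Jacobian 1/(2\<pi>),
  together 1/\<pi>.\<close>

lemma nn_integral_circle_chord:
  assumes [measurable]: "h \<in> borel_measurable borel"
  shows "(\<integral>\<^sup>+z. h (cmod (1 + z)) \<partial>circle_measure)
       = (\<integral>\<^sup>+\<theta>. h (2 * sin (\<theta> / 2)) \<partial>half_circle_measure)"
proof -
  define g where "g = (\<lambda>t. h (2 * \<bar>cos (pi * t)\<bar>))"
  define k where "k = (\<lambda>\<theta>. h (2 * sin (\<theta> / 2)) * indicator {0..pi} \<theta>)"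
  have [measurable]: "g \<in> borel_measurable borel" "k \<in> borel_measurable borel"
    unfolding g_def k_def by measurable
  have s: "0 \<le> sin (\<theta> / 2)" if "0 \<le> \<theta>" "\<theta> \<le> pi" for \<theta>
    using that by (intro sin_ge_zero) auto
  have g1: "g (1 / 2 + (- 1 / (2 * pi)) * \<theta>) = h (2 * sin (\<theta> / 2))"
   and g2: "g (1 / 2 + 1 / (2 * pi) * \<theta>) = h (2 * sin (\<theta> / 2))" if "0 \<le> \<theta>" "\<theta> \<le> pi" for \<theta>
    using s[OF that] by (simp_all add: g_def distrib_left cos_add cos_diff right_diff_distrib)
  have "(\<integral>\<^sup>+z. h (cmod (1 + z)) \<partial>circle_measure)
      = (\<integral>\<^sup>+t. g t * indicator {0..<1} t \<partial>lborel)"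
    using cmod_one_plus_cis[of "pi * t" for t]
    by (subst nn_integral_circle_measure) (auto simp: g_def mult.assoc)
  also have "\<dots> = (\<integral>\<^sup>+t. g t * indicator {0..<1/2} t + g t * indicator {1/2..<1} t \<partial>lborel)"
    by (intro nn_integral_cong) (auto simp: indicator_def)
  also have "\<dots> = (\<integral>\<^sup>+t. g t * indicator {0..<1/2} t \<partial>lborel) + (\<integral>\<^sup>+t. g t * indicator {1/2..<1} t \<partial>lborel)"
    by (rule nn_integral_add) auto
  also have "(\<integral>\<^sup>+t. g t * indicator {0..<1/2} t \<partial>lborel) = ennreal (1 / (2 * pi)) * (\<integral>\<^sup>+\<theta>. k \<theta> \<partial>lborel)"
  proof (subst nn_integral_real_affine[where c = "- 1 / (2 * pi)" and t = "1/2"])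
    show "ennreal \<bar>- 1 / (2 * pi)\<bar> * (\<integral>\<^sup>+\<theta>. g (1/2 + - 1 / (2 * pi) * \<theta>) * indicator {0..<1/2} (1/2 + - 1 / (2 * pi) * \<theta>) \<partial>lborel)
        = ennreal (1 / (2 * pi)) * (\<integral>\<^sup>+\<theta>. k \<theta> \<partial>lborel)"
    proof (rule arg_cong2[where f = "(*)"], simp, rule nn_integral_cong_AE,
        rule AE_mp[OF AE_lborel_singleton[of 0]], rule AE_I2, rule impI)
      \<comment> \<open>\<theta> = 0 corresponds to t = 1/2, which the half-open interval omits; in
        the second half the exception is \<theta> = \<pi>, that is t = 1.\<close>
      fix \<theta> :: real assume "\<theta> \<noteq> 0"
      then have "1/2 + - 1 / (2 * pi) * \<theta> \<in> {0..<1/2} \<longleftrightarrow> \<theta> \<in> {0..pi}"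
        by (auto simp: field_simps)
      then show "g (1/2 + - 1 / (2 * pi) * \<theta>) * indicator {0..<1/2} (1/2 + - 1 / (2 * pi) * \<theta>) = k \<theta>"
        using g1[of \<theta>] by (cases "\<theta> \<in> {0..pi}") (simp_all add: k_def)
    qed
  qed auto
  also have "(\<integral>\<^sup>+t. g t * indicator {1/2..<1} t \<partial>lborel) = ennreal (1 / (2 * pi)) * (\<integral>\<^sup>+\<theta>. k \<theta> \<partial>lborel)"
  proof (subst nn_integral_real_affine[where c = "1 / (2 * pi)" and t = "1/2"])
    show "ennreal \<bar>1 / (2 * pi)\<bar> * (\<integral>\<^sup>+\<theta>. g (1/2 + 1 / (2 * pi) * \<theta>) * indicator {1/2..<1} (1/2 + 1 / (2 * pi) * \<theta>) \<partial>lborel)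
        = ennreal (1 / (2 * pi)) * (\<integral>\<^sup>+\<theta>. k \<theta> \<partial>lborel)"
    proof (rule arg_cong2[where f = "(*)"], simp, rule nn_integral_cong_AE,
        rule AE_mp[OF AE_lborel_singleton[of pi]], rule AE_I2, rule impI)
      fix \<theta> :: real assume "\<theta> \<noteq> pi"
      then have "1/2 + 1 / (2 * pi) * \<theta> \<in> {1/2..<1} \<longleftrightarrow> \<theta> \<in> {0..pi}"
        by (auto simp: field_simps)
      then show "g (1/2 + 1 / (2 * pi) * \<theta>) * indicator {1/2..<1} (1/2 + 1 / (2 * pi) * \<theta>) = k \<theta>"
        using g2[of \<theta>] by (cases "\<theta> \<in> {0..pi}") (simp_all add: k_def)
    qed
  qed auto
  also have "ennreal (1 / (2 * pi)) * (\<integral>\<^sup>+\<theta>. k \<theta> \<partial>lborel) + ennreal (1 / (2 * pi)) * (\<integral>\<^sup>+\<theta>. k \<theta> \<partial>lborel)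
      = ennreal (1 / (2 * pi) + 1 / (2 * pi)) * (\<integral>\<^sup>+\<theta>. k \<theta> \<partial>lborel)"
    by (subst ennreal_plus) (auto simp: distrib_right)
  also have "1 / (2 * pi) + 1 / (2 * pi) = 1 / pi" by (simp add: field_simps)
  also have "ennreal (1 / pi) * (\<integral>\<^sup>+\<theta>. k \<theta> \<partial>lborel) = (\<integral>\<^sup>+\<theta>. h (2 * sin (\<theta> / 2)) \<partial>half_circle_measure)"
    by (subst nn_integral_half_circle_measure) (auto simp: k_def nn_integral_cmult)
  finally show ?thesis .
qed

text \<open>As an identity of distributions it transfers integrability, signed integrals and product
  measures alike.\<close>

lemma distr_circle_chord:
  "distr circle_measure borel (\<lambda>z. cmod (1 + z))
 = distr half_circle_measure borel (\<lambda>\<theta>. 2 * sin (\<theta> / 2))" (is "?L = ?R")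
proof (rule measure_eqI)
  fix A assume "A \<in> sets ?L"
  then have [measurable]: "A \<in> sets borel" by simp
  have "emeasure ?L A = (\<integral>\<^sup>+x. indicator A x \<partial>?L)" by simp
  also have "\<dots> = (\<integral>\<^sup>+z. indicator A (cmod (1 + z)) \<partial>circle_measure)"
    by (rule nn_integral_distr) measurable
  also have "\<dots> = (\<integral>\<^sup>+\<theta>. indicator A (2 * sin (\<theta> / 2)) \<partial>half_circle_measure)"
    by (rule nn_integral_circle_chord) measurable
  also have "\<dots> = (\<integral>\<^sup>+x. indicator A x \<partial>?R)"
    by (rule nn_integral_distr[symmetric]) measurable
  finally show "emeasure ?L A = emeasure ?R A" by simp
qed simp

lemma integral_half_circle_measure:
  fixes f :: "real \<Rightarrow> real"
  assumes [measurable]: "f \<in> borel_measurable borel"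
  shows "(\<integral>\<theta>. f \<theta> \<partial>half_circle_measure) = (LINT \<theta>:{0..pi}|lborel. f \<theta>) / pi"
  unfolding half_circle_measure_def set_lebesgue_integral_def
  by (subst integral_density) auto

lemma integrable_half_circle_measure:
  fixes f :: "real \<Rightarrow> real"
  assumes [measurable]: "f \<in> borel_measurable borel"
  shows "integrable half_circle_measure f \<longleftrightarrow> set_integrable lborel {0..pi} f"
proof -
  have "integrable half_circle_measure f \<longleftrightarrow> integrable lborel (\<lambda>\<theta>. indicator {0..pi} \<theta> / pi * f \<theta>)"
    unfolding half_circle_measure_def by (subst integrable_density) auto
  also have "(\<lambda>\<theta>. indicator {0..pi} \<theta> / pi * f \<theta>) = (\<lambda>\<theta>. (1 / pi) * (indicator {0..pi} \<theta> *\<^sub>R f \<theta>))"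
    by auto
  also have "integrable lborel \<dots> \<longleftrightarrow> set_integrable lborel {0..pi} f"
    unfolding set_integrable_def by (subst integrable_mult_left_iff) simp
  finally show ?thesis .
qed

section \<open>Integrability of powers of the logarithmic chord length\<close>

lemma sin_ge_chord:
  assumes "0 \<le> x" "x \<le> pi / 2"
  shows "2 * x / pi \<le> sin x"
proof -
  \<comment> \<open>Jordan's inequality: by concavity the sine lies above the chord from (0, 0) to
    (\<pi>/2, 1).\<close>
  have "convex_on {0..pi / 2} (\<lambda>x. - sin x)"
  proof (rule f''_ge0_imp_convex[where f' = "\<lambda>x. - cos x" and f'' = sin])
    show "\<And>x. x \<in> {0..pi/2} \<Longrightarrow> 0 \<le> sin x" by (auto intro!: sin_ge_zero)
  qed (auto intro!: derivative_eq_intros)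
  from convex_onD[OF this, of "2 * x / pi" 0 "pi / 2"] assms show ?thesis
    by (simp add: field_simps)
qed

text \<open>For s \<le> 2 the quantity ln(4/s) dominates both ln s and -ln s. The exponent 1/(2m) in
  ln y \<le> y^a / a is chosen so that the m-th power has exponent 1/2, which is integrable at
  0.\<close>

lemma abs_ln_power_le:
  assumes "0 < s" "s \<le> 2" "0 < m"
  shows "\<bar>ln s\<bar> ^ m \<le> (2 * real m) ^ m * (4 / s) powr (1/2)"
proof -
  have "ln s \<le> ln 2" "0 < ln (2 :: real)" using assms by simp_all
  moreover have "ln (4 / s) = 2 * ln 2 - ln s"
    using assms ln_powr[of 2 2] by (simp add: ln_div)
  ultimately have "\<bar>ln s\<bar> \<le> ln (4 / s)" by linarith
  also have "\<dots> \<le> (4 / s) powr (1 / (2 * real m)) / (1 / (2 * real m))"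
    using assms by (intro ln_powr_bound) (auto simp: field_simps)
  finally have "\<bar>ln s\<bar> ^ m \<le> (2 * real m * (4 / s) powr (1 / (2 * real m))) ^ m"
    by (intro power_mono) (auto simp: mult.commute)
  also have "\<dots> = (2 * real m) ^ m * (4 / s) powr (1/2)"
    using assms by (simp add: power_mult_distrib powr_power)
  finally show ?thesis .
qed

lemma integrable_ln_chord_power:
  "integrable half_circle_measure (\<lambda>\<theta>. ln (2 * sin (\<theta> / 2)) ^ m)"
proof -
  \<comment> \<open>Jordan's inequality gives 4 / (2 sin(\<theta>/2)) \<le> 2\<pi>/\<theta>, whence
    the factor 2\<pi>.\<close>
  define C where "C = (2 * real m) ^ m * (2 * pi) powr (1/2)"
  have "integrable lborel (\<lambda>x. indicator {0..pi} x * x powr (- 1/2))"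
  proof (rule integrableI_nonneg)
    have "(\<integral>\<^sup>+x. ennreal (indicator {0..pi} x * x powr (- 1/2)) \<partial>lborel) = pi powr (- 1/2 + 1) / (- 1/2 + 1)"
    proof (rule nn_integral_has_integral_lborel)
      have "((\<lambda>x. if x \<in> {0..pi} then x powr (- 1/2) else 0) has_integral pi powr (- 1/2 + 1) / (- 1/2 + 1)) UNIV"
        using has_integral_powr_from_0[of "- 1/2" pi] by (subst has_integral_restrict_UNIV) simp
      moreover have "(\<lambda>x. if x \<in> {0..pi} then x powr (- 1/2) else 0) = (\<lambda>x. indicator {0..pi} x * x powr (- 1/2))"
        by (auto simp: indicator_def)
      ultimately show "((\<lambda>x. indicator {0..pi} x * x powr (- 1/2)) has_integral pi powr (- 1/2 + 1) / (- 1/2 + 1)) UNIV"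
        by simp
    qed auto
    then show "(\<integral>\<^sup>+x. ennreal (indicator {0..pi} x * x powr (- 1/2)) \<partial>lborel) < \<infinity>" by simp
  qed auto
  then have "set_integrable lborel {0..pi} (\<lambda>x. x powr (- 1/2))"
    by (simp add: set_integrable_def)
  then have "set_integrable lborel {0..pi} (\<lambda>x. 1 + C * x powr (- 1/2))"
    by (intro set_integral_add(1) set_integrable_mult_right)
      (auto intro!: borel_integrable_atLeastAtMost')
  then have *: "integrable half_circle_measure (\<lambda>x. 1 + C * x powr (- 1/2))"
    by (subst integrable_half_circle_measure) auto
  \<comment> \<open>The summand 1 takes care of m = 0; at \<theta> = 0 with m > 0 the left side is 0
    because \<open>ln 0 = 0\<close>.\<close>
  have bd: "\<bar>ln (2 * sin (\<theta> / 2)) ^ m\<bar> \<le> 1 + C * \<theta> powr (- 1/2)" if "\<theta> \<in> {0..pi}" for \<theta>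
  proof (cases "\<theta> = 0 \<or> m = 0")
    case True
    then show ?thesis by (cases "m = 0") (auto simp: C_def zero_power)
  next
    case False
    with that have \<theta>: "0 < \<theta>" "\<theta> \<le> pi" "0 < m" by auto
    have s: "2 * \<theta> / pi \<le> 2 * sin (\<theta> / 2)" using sin_ge_chord[of "\<theta> / 2"] \<theta> by simp
    have s0: "0 < 2 * sin (\<theta> / 2)" using \<theta> by (intro mult_pos_pos sin_gt_zero) auto
    have "\<bar>ln (2 * sin (\<theta> / 2)) ^ m\<bar> \<le> (2 * real m) ^ m * (4 / (2 * sin (\<theta> / 2))) powr (1/2)"
      unfolding power_abs using s0 \<theta> by (intro abs_ln_power_le) auto
    also have "\<dots> \<le> (2 * real m) ^ m * (4 / (2 * \<theta> / pi)) powr (1/2)"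
      using s s0 \<theta> by (intro mult_left_mono powr_mono2 divide_left_mono) auto
    also have "4 / (2 * \<theta> / pi) = 2 * pi / \<theta>" by (simp add: field_simps)
    also have "(2 * real m) ^ m * (2 * pi / \<theta>) powr (1/2) = C * \<theta> powr (- 1/2)"
      using \<theta> by (simp add: C_def powr_divide powr_minus field_simps)
    finally show ?thesis by simp
  qed
  have ae: "AE \<theta> in half_circle_measure. \<theta> \<in> {0..pi}"
    unfolding half_circle_measure_def by (subst AE_density) (auto simp: indicator_def)
  show ?thesis
  proof (rule Bochner_Integration.integrable_bound[OF *])
    show "AE \<theta> in half_circle_measure. norm (ln (2 * sin (\<theta> / 2)) ^ m) \<le> norm (1 + C * \<theta> powr (- 1/2))"
      using ae
    proof eventually_elim
      case (elim \<theta>)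
      then show ?case using bd[OF elim] by simp
    qed
  qed measurable
qed

lemma integrable_circle_ln_power:
  "integrable circle_measure (\<lambda>z. ln (cmod (1 + z)) ^ m)"
proof -
  have "integrable (distr circle_measure borel (\<lambda>z. cmod (1 + z))) (\<lambda>x. ln x ^ m)"
    unfolding distr_circle_chord by (subst integrable_distr_eq) (auto intro: integrable_ln_chord_power)
  then show ?thesis by (subst (asm) integrable_distr_eq) auto
qed

text \<open>For w on the circle, rotation by \<open>- w\<close> reduces the claim to the point -1,
  the only one with chord length 0; this length is attained on [0, \<pi>] only at \<theta> = 0. The
  lemma discards the zeros of linear polynomials.\<close>

lemma AE_circle_neq: "AE z in circle_measure. z \<noteq> w"
proof (cases "cmod w = 1")
  case True
  have "emeasure circle_measure {w} = (\<integral>\<^sup>+z. indicator {w} z \<partial>circle_measure)" by simp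
  also have "\<dots> = (\<integral>\<^sup>+z. indicator {w} (- w * z) \<partial>circle_measure)"
    using True by (intro nn_integral_circle_rotate[symmetric]) auto
  also have "\<dots> = (\<integral>\<^sup>+z. indicator {0} (cmod (1 + z)) \<partial>circle_measure)"
  proof (rule nn_integral_cong)
    fix z
    have "w \<noteq> 0" using True by auto
    then have "- w * z = w \<longleftrightarrow> w * (1 + z) = 0" by (simp add: algebra_simps neg_eq_iff_add_eq_0)
    then have "- w * z = w \<longleftrightarrow> cmod (1 + z) = 0" using \<open>w \<noteq> 0\<close> by simp
    then show "indicator {w} (- w * z) = (indicator {0} (cmod (1 + z)) :: ennreal)"
      by (auto simp: indicator_def)
  qed
  also have "\<dots> = (\<integral>\<^sup>+\<theta>. indicator {0} (2 * sin (\<theta> / 2)) \<partial>half_circle_measure)"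
    by (rule nn_integral_circle_chord) auto
  also have "\<dots> = (\<integral>\<^sup>+\<theta>. ennreal (1 / pi) * (indicator {0} (2 * sin (\<theta> / 2)) * indicator {0..pi} \<theta>) \<partial>lborel)"
    by (rule nn_integral_half_circle_measure) measurable
  also have "\<dots> = (\<integral>\<^sup>+\<theta>. 0 \<partial>(lborel :: real measure))"
  proof (rule nn_integral_cong_AE, rule AE_mp[OF AE_lborel_singleton[of 0]], rule AE_I2, rule impI)
    fix \<theta> :: real assume "\<theta> \<noteq> 0"
    then show "ennreal (1 / pi) * (indicator {0} (2 * sin (\<theta> / 2)) * indicator {0..pi} \<theta>) = 0"
      using sin_gt_zero[of "\<theta> / 2"] by (auto simp: indicator_def)
  qed
  finally have "emeasure circle_measure {w} = 0" by simp
  then show ?thesis by (intro AE_I[of _ _ "{w}"]) auto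
next
  case False
  then show ?thesis using AE_circle_measure_norm by (auto elim: eventually_mono)
qed

subsection \<open>Jensen's formula for linear polynomials\<close>

text \<open>\<open>1 + a * z\<close> has positive real part on the closed unit disc, so its
  principal logarithm is holomorphic there. Cauchy's formula at 0 gives the mean value Ln 1 = 0, and
  the real part is the claim.\<close>

lemma jensen_open_disc:
  assumes a: "cmod a < 1"
  shows "has_bochner_integral circle_measure (\<lambda>z. ln (cmod (1 + a * z))) 0"
proof -
  have Re: "0 < Re (1 + a * z)" if "cmod z \<le> 1" for z
  proof -
    have "cmod (a * z) \<le> cmod a * 1" unfolding norm_mult using that by (intro mult_left_mono) auto
    then show ?thesis using a abs_Re_le_cmod[of "a * z"] by auto
  qed
  then have nz: "1 + a * z \<notin> \<real>\<^sub>\<le>\<^sub>0" if "cmod z \<le> 1" for z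
    using that by (force simp: complex_nonpos_Reals_iff)
  then have nz0: "1 + a * z \<noteq> 0" if "cmod z \<le> 1" for z using that by fastforce
  have "(\<lambda>z. Ln (1 + a * z)) holomorphic_on cball 0 1"
    using nz by (intro holomorphic_intros) auto
  from Cauchy_integral_circlepath_simple[OF this, of 0]
  have "((\<lambda>t. Ln (1 + a * circlepath 0 1 t) / circlepath 0 1 t
            * vector_derivative (circlepath 0 1) (at t within {0..1})) has_integral 0) {0..1}"
    by (simp add: has_contour_integral_def)
  then have "((\<lambda>t. (2 * pi * \<i>) * Ln (1 + a * cis (2 * pi * t))) has_integral 0) {0..1}"
  proof (rule has_integral_eq[rotated])
    fix t :: real assume "t \<in> {0..1}"
    have c: "circlepath 0 1 t = cis (2 * pi * t)"
      by (simp add: circlepath cis_conv_exp algebra_simps)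
    have "vector_derivative (circlepath 0 1) (at t within {0..1}) = 2 * pi * \<i> * cis (2 * pi * t)"
      using \<open>t \<in> {0..1}\<close> by (subst vector_derivative_circlepath01) (auto simp: cis_conv_exp algebra_simps)
    then show "Ln (1 + a * circlepath 0 1 t) / circlepath 0 1 t
        * vector_derivative (circlepath 0 1) (at t within {0..1}) = (2 * pi * \<i>) * Ln (1 + a * cis (2 * pi * t))"
      by (simp add: c)
  qed
  from has_integral_mult_right[OF this, of "1 / (2 * pi * \<i>)"]
  have "((\<lambda>t. Ln (1 + a * cis (2 * pi * t))) has_integral 0) {0..1}" by simp
  from has_integral_Re[OF this]
  have hi: "((\<lambda>t. ln (cmod (1 + a * cis (2 * pi * t)))) has_integral 0) {0..1}"
    using nz0 by (simp add: Re_Ln)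
  have si: "set_integrable lborel {0..1} (\<lambda>t. ln (cmod (1 + a * cis (2 * pi * t))))"
    using nz0 by (intro borel_integrable_atLeastAtMost' continuous_intros) auto
  have "integrable circle_measure (\<lambda>z. ln (cmod (1 + a * z)))"
    unfolding circle_measure_def using si
    by (subst integrable_distr_eq) (auto simp: integrable_restrict_space set_integrable_def)
  moreover have "(\<integral>z. ln (cmod (1 + a * z)) \<partial>circle_measure) = 0"
    using set_borel_integral_eq_integral(2)[OF si] hi
    by (subst integral_circle_measure) (auto simp: integral_unique)
  ultimately show ?thesis by (simp add: has_bochner_integral_iff)
qed

text \<open>The limit $r \to 1$ of the open disc case is dominated because $|1 + r z| \ge |1 + z| / 2$
  on the unit circle.\<close>

lemma integral_circle_ln_chord: "(\<integral>z. ln (cmod (1 + z)) \<partial>circle_measure) = 0"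
proof -
  define r where "r = (\<lambda>n. 1 - inverse (real (Suc n)))"
  have r: "0 \<le> r n" "r n < 1" for n by (auto simp: r_def field_simps)
  have r_lim: "r \<longlonglongrightarrow> 1"
    unfolding r_def using tendsto_diff[OF tendsto_const LIMSEQ_inverse_real_of_nat, of 1] by simp
  have "(\<lambda>n. \<integral>z. ln (cmod (1 + complex_of_real (r n) * z)) \<partial>circle_measure)
      \<longlonglongrightarrow> (\<integral>z. ln (cmod (1 + z)) \<partial>circle_measure)"
  proof (rule integral_dominated_convergence)
    show "integrable circle_measure (\<lambda>z. ln 2 + \<bar>ln (cmod (1 + z))\<bar>)"
      using integrable_circle_ln_power[of 1] by simp
    show "AE z in circle_measure. (\<lambda>n. ln (cmod (1 + complex_of_real (r n) * z))) \<longlonglongrightarrow> ln (cmod (1 + z))"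
      using AE_circle_neq[of "- 1"]
    proof eventually_elim
      case (elim z)
      then have "1 + z \<noteq> 0" by (simp add: add_eq_0_iff)
      have "(\<lambda>n. 1 + complex_of_real (r n) * z) \<longlonglongrightarrow> 1 + of_real 1 * z"
        by (intro tendsto_intros r_lim)
      with \<open>1 + z \<noteq> 0\<close> show ?case
        by (intro tendsto_ln tendsto_norm) auto
    qed
    show "AE z in circle_measure. norm (ln (cmod (1 + complex_of_real (r n) * z))) \<le> ln 2 + \<bar>ln (cmod (1 + z))\<bar>" for n
      using AE_circle_neq[of "- 1"] AE_circle_measure_norm
    proof eventually_elim
      case (elim z)
      then have "1 + z \<noteq> 0" by (simp add: add_eq_0_iff)
      then have pos: "0 < cmod (1 + z)" by simp
      have rz: "cmod (of_real (r n) * z) = r n" using elim r[of n] by (simp add: norm_mult)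
      have "cmod ((1 - of_real (r n)) * z) = 1 - r n"
        using elim r[of n] norm_of_real[of "1 - r n", where 'a = complex] by (simp add: norm_mult)
      moreover have "1 + z = (1 + of_real (r n) * z) + (1 - of_real (r n)) * z"
        by (simp add: algebra_simps)
      \<comment> \<open>Since |rz| = r, also 1 - r \<le> |1 + rz|; the two estimates together cost
        the factor 2.\<close>
      ultimately have "cmod (1 + z) \<le> cmod (1 + of_real (r n) * z) + (1 - r n)"
        by (metis norm_triangle_ineq)
      moreover have "1 - r n \<le> cmod (1 + of_real (r n) * z)"
        using norm_triangle_ineq4[of "1 + of_real (r n) * z" "of_real (r n) * z"] rz by simp
      ultimately have lower: "cmod (1 + z) / 2 \<le> cmod (1 + of_real (r n) * z)" by simp
      have upper: "cmod (1 + of_real (r n) * z) \<le> 2"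
        using norm_triangle_ineq[of 1 "of_real (r n) * z"] rz r[of n] by simp
      have "ln (cmod (1 + z)) - ln 2 = ln (cmod (1 + z) / 2)"
        using \<open>1 + z \<noteq> 0\<close> by (simp add: ln_div)
      also have "\<dots> \<le> ln (cmod (1 + of_real (r n) * z))"
        using lower pos by (subst ln_le_cancel_iff) auto
      finally have "ln (cmod (1 + z)) - ln 2 \<le> ln (cmod (1 + of_real (r n) * z))" .
      moreover have "ln (cmod (1 + of_real (r n) * z)) \<le> ln 2"
        using upper lower pos by (subst ln_le_cancel_iff) auto
      ultimately show ?case by auto
    qed
  qed measurable
  moreover have "(\<integral>z. ln (cmod (1 + complex_of_real (r n) * z)) \<partial>circle_measure) = 0" for n
    using r[of n] by (intro has_bochner_integral_integral_eq[OF jensen_open_disc]) simp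
  ultimately show ?thesis by (simp add: LIMSEQ_const_iff)
qed

text \<open>If |a| = 1, then az is again uniform on the circle, which reduces the claim to a =
  1.\<close>

lemma jensen_closed_disc:
  assumes "cmod a \<le> 1"
  shows "has_bochner_integral circle_measure (\<lambda>z. ln (cmod (1 + a * z))) 0"
proof (cases "cmod a < 1")
  case True
  then show ?thesis by (rule jensen_open_disc)
next
  case False
  with assms have "cmod a = 1" by simp
  then have D: "distr circle_measure borel (\<lambda>z. a * z) = circle_measure" by (rule distr_circle_rotate)
  have "has_bochner_integral (distr circle_measure borel (\<lambda>z. a * z)) (\<lambda>z. ln (cmod (1 + z))) 0"
    unfolding D using integrable_circle_ln_power[of 1] integral_circle_ln_chord
    by (simp add: has_bochner_integral_iff)
  then show ?thesis
    by (simp add: has_bochner_integral_iff integrable_distr_eq integral_distr)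
qed

text \<open>With the maximum inside the logarithm the formula also covers $a = 0$ and $b = 0$,
  because \<open>ln 0 = 0\<close>.\<close>

lemma jensen_linear:
  "has_bochner_integral circle_measure (\<lambda>z. ln (cmod (a + b * z))) (ln (max (cmod a) (cmod b)))"
proof -
  \<comment> \<open>The coefficient of larger modulus R is factored out, leaving c in the closed
    disc. The identity is required on the unit circle only, because one case below uses 1/z =
    \<open>cnj z\<close>.\<close>
  have shift: "has_bochner_integral circle_measure (\<lambda>z. ln (cmod (a + b * z))) (ln R)"
    if "0 < R" "cmod c \<le> 1" and eq: "\<And>z. cmod z = 1 \<Longrightarrow> cmod (a + b * z) = R * cmod (1 + c * z)" for R c
  proof -
    \<comment> \<open>With \<open>ln 0 = 0\<close> the logarithm of the product splits only where
      the second factor is nonzero.\<close>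
    have "AE z in circle_measure. 1 + c * z \<noteq> 0"
    proof (cases "c = 0")
      case False
      have "AE z in circle_measure. z \<noteq> - 1 / c" by (rule AE_circle_neq)
      then show ?thesis
        by eventually_elim (use False in \<open>auto simp: field_simps add_eq_0_iff\<close>)
    qed simp
    then have ae: "AE z in circle_measure. ln R + ln (cmod (1 + c * z)) = ln (cmod (a + b * z))"
      using AE_circle_measure_norm
      by eventually_elim (use eq \<open>0 < R\<close> in \<open>auto simp: ln_mult\<close>)
    have "has_bochner_integral circle_measure (\<lambda>z. ln R + ln (cmod (1 + c * z))) (ln R + 0)"
      using jensen_closed_disc[OF that(2)]
      by (intro has_bochner_integral_add) (auto simp: has_bochner_integral_iff circle.prob_space[simplified])
    then show ?thesis
      using has_bochner_integral_cong_AE[OF _ _ ae] by simp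
  qed
  consider "a = 0" "b = 0" | "a \<noteq> 0" "cmod b \<le> cmod a" | "b \<noteq> 0" "cmod a \<le> cmod b"
    by fastforce
  then show ?thesis
  proof cases
    case 1
    then show ?thesis by (simp add: has_bochner_integral_iff)
  next
    case 2
    have "a + b * z = a * (1 + b / a * z)" for z
      using 2 by (simp add: field_simps)
    then have "cmod (a + b * z) = cmod a * cmod (1 + b / a * z)" for z
      by (simp only: norm_mult)
    with 2 have "has_bochner_integral circle_measure (\<lambda>z. ln (cmod (a + b * z))) (ln (cmod a))"
      by (intro shift[of _ "b / a"]) (auto simp: norm_divide)
    then show ?thesis using 2 by (simp add: max_def)
  next
    case 3
    \<comment> \<open>Factoring out bz leaves 1 + (a/b) \<open>cnj z\<close> on the circle;
      conjugation keeps the modulus and makes it linear in z.\<close>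
    have "cmod (a + b * z) = cmod b * cmod (1 + cnj (a / b) * z)" if "cmod z = 1" for z
    proof -
      have z: "z * cnj z = 1" using that by (simp add: complex_norm_square[symmetric])
      have "b * (z * (1 + a / b * cnj z)) = b * z + a * (z * cnj z)"
        using 3 by (simp add: field_simps)
      then have "a + b * z = b * (z * (1 + a / b * cnj z))" by (simp only: z) simp
      then have "cmod (a + b * z) = cmod b * cmod (z * (1 + a / b * cnj z))"
        by (simp only: norm_mult)
      also have "cmod (z * (1 + a / b * cnj z)) = cmod (cnj (1 + a / b * cnj z))"
        unfolding complex_mod_cnj using that by (simp add: norm_mult)
      finally show ?thesis by simp
    qed
    with 3 have "has_bochner_integral circle_measure (\<lambda>z. ln (cmod (a + b * z))) (ln (cmod b))"
      by (intro shift[of _ "cnj (a / b)"]) (auto simp: norm_divide)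
    then show ?thesis using 3 by (simp add: max_def)
  qed
qed

text \<open>If t \<le> M and 0 \<le> M, then |t| \<le> 2M - t. Here M = ln 4 comes from |a + bz|
  \<le> 2 + 2, and Jensen's formula integrates the term -t exactly.\<close>

lemma jensen_linear_abs:
  assumes "cmod a \<le> 2" "cmod b \<le> 2"
  shows "(\<integral>z. \<bar>ln (cmod (a + b * z))\<bar> \<partial>circle_measure)
       \<le> 2 * ln 4 + \<bar>ln (cmod a)\<bar> + \<bar>ln (cmod b)\<bar>"
proof -
  note J = jensen_linear[of a b, unfolded has_bochner_integral_iff]
  have "AE z in circle_measure. \<bar>ln (cmod (a + b * z))\<bar> \<le> 2 * ln 4 - ln (cmod (a + b * z))"
    using AE_circle_measure_norm
  proof eventually_elim
    case (elim z)
    have "cmod (a + b * z) \<le> 4"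
      using norm_triangle_ineq[of a "b * z"] assms elim by (simp add: norm_mult)
    then have "ln (cmod (a + b * z)) \<le> ln 4"
      by (cases "a + b * z = 0") auto
    moreover have "0 \<le> ln (4 :: real)" by simp
    ultimately show ?case by linarith
  qed
  then have "(\<integral>z. \<bar>ln (cmod (a + b * z))\<bar> \<partial>circle_measure)
      \<le> (\<integral>z. 2 * ln 4 - ln (cmod (a + b * z)) \<partial>circle_measure)"
    using J by (intro integral_mono_AE) auto
  also have "\<dots> = 2 * ln 4 - ln (max (cmod a) (cmod b))"
    using J by (simp add: circle.prob_space[simplified])
  also have "\<dots> \<le> 2 * ln 4 + \<bar>ln (cmod a)\<bar> + \<bar>ln (cmod b)\<bar>"
    by (auto simp: max_def)
  finally show ?thesis .
qed

subsection \<open>Reduction to two angles\<close>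

lemma (in pair_sigma_finite) integrable_product_mult:
  fixes f g :: "_ \<Rightarrow> real"
  assumes [measurable]: "integrable M1 f" "integrable M2 g"
  shows "integrable (M1 \<Otimes>\<^sub>M M2) (\<lambda>p. f (fst p) * g (snd p))"
  using assms by (intro Fubini_integrable) (auto simp: abs_mult)

text \<open>The L1 norm in y is bounded by \<open>jensen_linear_abs\<close> with a = 1 + x and b = 1
  + w. Times |log |1+x||^k, this bound is a sum of products of a function of x and a function of w,
  each integrable.\<close>

lemma integrable_torus_integrand:
  "integrable ((circle_measure \<Otimes>\<^sub>M circle_measure) \<Otimes>\<^sub>M circle_measure)
     (\<lambda>q. ln (cmod (1 + fst (fst q))) ^ k
        * ln (cmod ((1 + fst (fst q)) + (1 + snd (fst q)) * snd q)))"
  (is "integrable _ ?f")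
proof (rule circle3.Fubini_integrable)
  define L where "L = (\<lambda>x. ln (cmod (1 + x)))"
  have [measurable]: "L \<in> borel_measurable borel" unfolding L_def by measurable
  \<comment> \<open>The factors 1 are constant functions of w, giving each summand the shape
    required by \<open>integrable_product_mult\<close>.\<close>
  define B where "B = (\<lambda>p. 2 * ln 4 * (\<bar>L (fst p)\<bar> ^ k * 1) + \<bar>L (fst p)\<bar> ^ Suc k * 1
    + \<bar>L (fst p)\<bar> ^ k * \<bar>L (snd p)\<bar>)"
  define G where "G = (\<lambda>p. \<integral>y. norm (?f (p, y)) \<partial>circle_measure)"
  show f: "?f \<in> borel_measurable ((circle_measure \<Otimes>\<^sub>M circle_measure) \<Otimes>\<^sub>M circle_measure)"
    by measurable
  have G_meas: "G \<in> borel_measurable (circle_measure \<Otimes>\<^sub>M circle_measure)"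
    unfolding G_def using f by (intro circle.borel_measurable_lebesgue_integral) simp
  have I: "integrable circle_measure (\<lambda>x. \<bar>L x\<bar> ^ m)" for m
    using integrable_abs[OF integrable_circle_ln_power[of m]] by (simp add: power_abs L_def)
  have B_int: "integrable (circle_measure \<Otimes>\<^sub>M circle_measure) B"
    unfolding B_def using I[of k] I[of "Suc k"] I[of 1]
    by (intro Bochner_Integration.integrable_add integrable_mult_right circle2.integrable_product_mult) auto
  have G_nn: "0 \<le> G p" for p unfolding G_def by simp
  have GB: "G (x, w) \<le> B (x, w)" if "cmod x = 1" "cmod w = 1" for x w
  proof -
    have "cmod (1 + x) \<le> 2" "cmod (1 + w) \<le> 2"
      using norm_triangle_ineq[of 1 x] norm_triangle_ineq[of 1 w] that by simp_all
    note J = mult_left_mono[OF jensen_linear_abs[OF this], of "\<bar>L x\<bar> ^ k"]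
    have "G (x, w) = \<bar>L x\<bar> ^ k * (\<integral>y. \<bar>ln (cmod ((1 + x) + (1 + w) * y))\<bar> \<partial>circle_measure)"
      by (simp add: G_def L_def abs_mult power_abs)
    also have "\<dots> \<le> \<bar>L x\<bar> ^ k * (2 * ln 4 + \<bar>L x\<bar> + \<bar>L w\<bar>)"
      using J by (simp add: L_def)
    also have "\<dots> = B (x, w)" by (simp add: B_def distrib_left)
    finally show ?thesis .
  qed
  have "AE p in circle_measure \<Otimes>\<^sub>M circle_measure. G p \<le> B p"
  proof (rule circle2.AE_pair_measure)
    show "{p \<in> space (circle_measure \<Otimes>\<^sub>M circle_measure). G p \<le> B p} \<in> sets (circle_measure \<Otimes>\<^sub>M circle_measure)"
      using G_meas B_int by (intro borel_measurable_le) auto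
    show "AE x in circle_measure. AE w in circle_measure. G (x, w) \<le> B (x, w)"
      using AE_circle_measure_norm
    proof eventually_elim
      case (elim x)
      show ?case using AE_circle_measure_norm by eventually_elim (rule GB[OF elim])
    qed
  qed
  then have "AE p in circle_measure \<Otimes>\<^sub>M circle_measure. norm (G p) \<le> norm (B p)"
    by eventually_elim (use G_nn order_trans in fastforce)
  then show "integrable (circle_measure \<Otimes>\<^sub>M circle_measure) (\<lambda>p. \<integral>y. norm (?f (p, y)) \<partial>circle_measure)"
    unfolding G_def[symmetric] by (rule Bochner_Integration.integrable_bound[OF B_int G_meas])
  show "AE p in circle_measure \<Otimes>\<^sub>M circle_measure. integrable circle_measure (\<lambda>y. ?f (p, y))"
    using jensen_linear by (auto simp: has_bochner_integral_iff)
qed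

lemma multi_mahler_eq_torus:
  "multi_mahler 3 (replicate k (\<lambda>v. 1 + v 0) @ [\<lambda>v. 1 + v 0 + v 1 + v 2])
   = (\<integral>p. ln (cmod (1 + fst p)) ^ k * ln (max (cmod (1 + fst p)) (cmod (1 + snd p)))
        \<partial>(circle_measure \<Otimes>\<^sub>M circle_measure))"
proof -
  let ?C = "(circle_measure \<Otimes>\<^sub>M circle_measure) \<Otimes>\<^sub>M circle_measure"
  let ?f = "\<lambda>q. ln (cmod (1 + fst (fst q))) ^ k
        * ln (cmod ((1 + fst (fst q)) + (1 + snd (fst q)) * snd q))"
  let ?P = "PiM {..<3::nat} (\<lambda>_. restrict_space lborel {0..1::real})"
  let ?T = "\<lambda>t. ((cis (2 * pi * t 0), cis (2 * pi * t 2) / cis (2 * pi * t 1)), cis (2 * pi * t 1))"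
  have e: "(\<lambda>t. cis (2 * pi * t i)) \<in> borel_measurable ?P" if "i < 3" for i
    by (rule measurable_compose[OF _ measurable_circle], rule measurable_component_singleton) (use that in auto)
  have [measurable]: "?T \<in> measurable ?P ?C"
    using e[of 0] e[of 1] e[of 2] by (intro measurable_Pair borel_measurable_divide) auto
  have "multi_mahler 3 (replicate k (\<lambda>v. 1 + v 0) @ [\<lambda>v. 1 + v 0 + v 1 + v 2])
      = (\<integral>t. ?f (?T t) \<partial>?P)"
    \<comment> \<open>With y = \<open>cis (2 * pi * t 1)\<close> and w = z / y, the product (1 + w)
      y is y + z.\<close>
    unfolding multi_mahler_def
    by (simp add: map_replicate prod_list_replicate algebra_simps)
  also have "\<dots> = (\<integral>q. ?f q \<partial>distr ?P ?C ?T)"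
    by (rule integral_distr[symmetric]) measurable
  also have "\<dots> = (\<integral>q. ?f q \<partial>?C)" by (simp only: distr_torus_shear)
  also have "\<dots> = (\<integral>p. (\<integral>y. ?f (p, y) \<partial>circle_measure) \<partial>(circle_measure \<Otimes>\<^sub>M circle_measure))"
    by (rule circle3.integral_fst'[OF integrable_torus_integrand, symmetric])
  also have "\<dots> = (\<integral>p. ln (cmod (1 + fst p)) ^ k * ln (max (cmod (1 + fst p)) (cmod (1 + snd p)))
        \<partial>(circle_measure \<Otimes>\<^sub>M circle_measure))"
  proof (rule Bochner_Integration.integral_cong[OF refl])
    fix p
    show "(\<integral>y. ?f (p, y) \<partial>circle_measure)
        = ln (cmod (1 + fst p)) ^ k * ln (max (cmod (1 + fst p)) (cmod (1 + snd p)))"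
      using has_bochner_integral_integral_eq[OF jensen_linear[of "1 + fst p" "1 + snd p"]]
      by (simp add: case_prod_beta)
  qed
  finally show ?thesis .
qed

section \<open>From the torus to a square of angles\<close>

interpretation half_circle: prob_space half_circle_measure
proof (rule prob_spaceI)
  show "emeasure half_circle_measure (space half_circle_measure) = 1"
    using nn_integral_circle_chord[of "\<lambda>_. 1"] circle.emeasure_space_1 by simp
qed

interpretation half_circle2: pair_prob_space half_circle_measure half_circle_measure ..

text \<open>Both sides equal the integral of \<open>f\<close> over the product of the chord-length
  distribution with itself, since a product of image measures is the image of the product
  measure.\<close>

lemma integral_torus_eq_square:
  assumes [measurable]: "(\<lambda>p. f (fst p) (snd p) :: real) \<in> borel_measurable (borel \<Otimes>\<^sub>M borel)"
  shows "(\<integral>p. f (cmod (1 + fst p)) (cmod (1 + snd p)) \<partial>(circle_measure \<Otimes>\<^sub>M circle_measure))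
       = (\<integral>p. f (2 * sin (fst p / 2)) (2 * sin (snd p / 2)) \<partial>(half_circle_measure \<Otimes>\<^sub>M half_circle_measure))"
proof -
  let ?c = "\<lambda>z. cmod (1 + z)" and ?s = "\<lambda>\<theta>::real. 2 * sin (\<theta> / 2)"
  let ?S = "distr circle_measure borel ?c"
  have "prob_space ?S" by (rule circle.prob_space_distr) measurable
  then interpret S: prob_space ?S .
  have S1: "?S \<Otimes>\<^sub>M ?S = distr (circle_measure \<Otimes>\<^sub>M circle_measure) (borel \<Otimes>\<^sub>M borel) (\<lambda>(x, y). (?c x, ?c y))"
    by (rule pair_measure_distr) (auto intro: S.sigma_finite_measure_axioms)
  have S2: "?S \<Otimes>\<^sub>M ?S = distr (half_circle_measure \<Otimes>\<^sub>M half_circle_measure) (borel \<Otimes>\<^sub>M borel) (\<lambda>(x, y). (?s x, ?s y))"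
    using S.sigma_finite_measure_axioms unfolding distr_circle_chord by (intro pair_measure_distr) auto
  have "(\<integral>p. f (?c (fst p)) (?c (snd p)) \<partial>(circle_measure \<Otimes>\<^sub>M circle_measure))
      = (\<integral>p. f (fst p) (snd p) \<partial>(?S \<Otimes>\<^sub>M ?S))"
    unfolding S1 by (subst integral_distr) (auto simp: case_prod_beta)
  also have "\<dots> = (\<integral>p. f (?s (fst p)) (?s (snd p)) \<partial>(half_circle_measure \<Otimes>\<^sub>M half_circle_measure))"
    unfolding S2 by (subst integral_distr) (auto simp: case_prod_beta)
  finally show ?thesis .
qed

section \<open>Log-sine integrals as half-circle integrals\<close>

lemma AE_half_circle_measure: "AE \<theta> in half_circle_measure. \<theta> \<in> {0<..pi}"
proof -
  have "AE \<theta> in lborel. 0 < ennreal (indicator {0..pi} \<theta> / pi) \<longrightarrow> \<theta> \<in> {0<..pi}"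
    by (rule AE_mp[OF AE_lborel_singleton[of 0]]) (auto simp: indicator_def)
  then show ?thesis unfolding half_circle_measure_def by (subst AE_density) auto
qed

text \<open>Two functions appear because \<open>g\<close> will be written with \<open>Ls\<close> and
  agree only on [0, \<pi>] with an inner integral \<open>f\<close> whose measurability is
  known.\<close>

lemma interval_integral_eq_half_circle:
  fixes f g :: "real \<Rightarrow> real"
  assumes "f \<in> borel_measurable borel" and "\<And>\<theta>. 0 \<le> \<theta> \<Longrightarrow> \<theta> \<le> pi \<Longrightarrow> f \<theta> = g \<theta>"
  shows "(LBINT \<theta>=0..pi. g \<theta>) = pi * (\<integral>\<theta>. f \<theta> \<partial>half_circle_measure)"
proof -
  have "(LBINT \<theta>=0..pi. g \<theta>) = (LINT \<theta>:{0..pi}|lborel. g \<theta>)"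
    using interval_integral_Icc[of 0 pi g] by (simp add: zero_ereal_def)
  also have "\<dots> = (LINT \<theta>:{0..pi}|lborel. f \<theta>)"
    using assms(2) by (intro set_lebesgue_integral_cong) auto
  finally show ?thesis using integral_half_circle_measure[OF assms(1)] by simp
qed

text \<open>On [0, \<pi>] the half-angle sine is nonnegative, so the absolute value disappears. The
  strict \<open>\<theta> < \<sigma>\<close> matches the region above the diagonal in the final
  splitting.\<close>

lemma Ls_eq_half_circle:
  assumes "0 \<le> \<sigma>" "\<sigma> \<le> pi"
  shows "Ls n \<sigma> = - pi * (\<integral>\<theta>. of_bool (\<theta> < \<sigma>) * ln (2 * sin (\<theta> / 2)) ^ (n - 1) \<partial>half_circle_measure)"
proof -
  have s: "0 \<le> sin (\<theta> / 2)" if "0 \<le> \<theta>" "\<theta> \<le> pi" for \<theta>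
    using that by (intro sin_ge_zero) auto
  have "(LBINT \<theta>=0..\<sigma>. ln \<bar>2 * sin (\<theta> / 2)\<bar> ^ (n - 1)) = (LINT \<theta>:{0..\<sigma>}|lborel. ln \<bar>2 * sin (\<theta> / 2)\<bar> ^ (n - 1))"
    using interval_integral_Icc[of 0 \<sigma> "\<lambda>\<theta>. ln \<bar>2 * sin (\<theta> / 2)\<bar> ^ (n - 1)"] assms
    by (simp add: zero_ereal_def)
  also have "\<dots> = (LINT \<theta>:{0..pi}|lborel. of_bool (\<theta> < \<sigma>) * ln (2 * sin (\<theta> / 2)) ^ (n - 1))"
    unfolding set_lebesgue_integral_def
  proof (rule integral_cong_AE)
    show "AE \<theta> in lborel. indicator {0..\<sigma>} \<theta> *\<^sub>R ln \<bar>2 * sin (\<theta> / 2)\<bar> ^ (n - 1)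
        = indicator {0..pi} \<theta> *\<^sub>R (of_bool (\<theta> < \<sigma>) * ln (2 * sin (\<theta> / 2)) ^ (n - 1))"
      using AE_lborel_singleton[of \<sigma>]
      by eventually_elim (use assms s in \<open>auto simp: indicator_def\<close>)
  qed measurable
  also have "\<dots> = pi * (\<integral>\<theta>. of_bool (\<theta> < \<sigma>) * ln (2 * sin (\<theta> / 2)) ^ (n - 1) \<partial>half_circle_measure)"
    by (subst integral_half_circle_measure) auto
  finally show ?thesis by (simp add: Ls_def)
qed

text \<open>This is Ls_2(\<pi>) = 0, carried over from the circle.\<close>

lemma integral_half_circle_ln_chord: "(\<integral>\<theta>. ln (2 * sin (\<theta> / 2)) \<partial>half_circle_measure) = 0"
proof -
  have "(\<integral>\<theta>. ln (2 * sin (\<theta> / 2)) \<partial>half_circle_measure)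
      = (\<integral>x. ln x \<partial>distr half_circle_measure borel (\<lambda>\<theta>. 2 * sin (\<theta> / 2)))"
    by (rule integral_distr[symmetric]) measurable
  also have "\<dots> = (\<integral>z. ln (cmod (1 + z)) \<partial>circle_measure)"
    unfolding distr_circle_chord[symmetric] by (rule integral_distr) measurable
  finally show ?thesis by (simp add: integral_circle_ln_chord)
qed

lemma integral_half_circle_of_bool_le:
  assumes "0 \<le> \<theta>" "\<theta> \<le> pi"
  shows "(\<integral>\<omega>. of_bool (\<omega> \<le> \<theta>) \<partial>half_circle_measure) = \<theta> / pi"
proof -
  have "(\<integral>\<omega>. of_bool (\<omega> \<le> \<theta>) \<partial>half_circle_measure)
      = (LINT \<omega>:{0..pi}|lborel. of_bool (\<omega> \<le> \<theta>)) / pi"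
    by (rule integral_half_circle_measure) measurable
  also have "(LINT \<omega>:{0..pi}|lborel. of_bool (\<omega> \<le> \<theta>)) = (\<integral>\<omega>. indicator {0..\<theta>} \<omega> \<partial>lborel)"
    unfolding set_lebesgue_integral_def
    using assms by (intro Bochner_Integration.integral_cong) (auto simp: indicator_def)
  finally show ?thesis using assms by simp
qed

text \<open>The integral over all \<omega> vanishes, so the tail is minus the head. This change of
  sign is why the two formulas of the theorem carry opposite signs.\<close>

lemma integral_half_circle_ln_tail:
  assumes "0 \<le> \<theta>" "\<theta> \<le> pi"
  shows "(\<integral>\<omega>. of_bool (\<theta> < \<omega>) * ln (2 * sin (\<omega> / 2)) \<partial>half_circle_measure) = Ls 2 \<theta> / pi"
proof -
  define L where "L = (\<lambda>\<omega>::real. ln (2 * sin (\<omega> / 2)))"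
  have [measurable]: "L \<in> borel_measurable borel" unfolding L_def by measurable
  have L: "integrable half_circle_measure L"
    using integrable_ln_chord_power[of 1] by (simp add: L_def)
  have sub: "integrable half_circle_measure (\<lambda>\<omega>. of_bool (P \<omega>) * L \<omega>)"
    if [measurable]: "Measurable.pred borel P" for P
    by (rule Bochner_Integration.integrable_bound[OF L]) auto
  have "AE \<omega> in half_circle_measure. \<omega> \<noteq> \<theta>"
    unfolding half_circle_measure_def
    by (subst AE_density) (auto intro: AE_mp[OF AE_lborel_singleton[of \<theta>]])
  then have "(\<integral>\<omega>. of_bool (\<theta> < \<omega>) * L \<omega> + of_bool (\<omega> < \<theta>) * L \<omega> \<partial>half_circle_measure)
      = (\<integral>\<omega>. L \<omega> \<partial>half_circle_measure)"
    by (intro integral_cong_AE) (auto elim!: eventually_mono)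
  also have "\<dots> = 0" using integral_half_circle_ln_chord by (simp add: L_def)
  finally have "(\<integral>\<omega>. of_bool (\<theta> < \<omega>) * L \<omega> \<partial>half_circle_measure)
      = - (\<integral>\<omega>. of_bool (\<omega> < \<theta>) * L \<omega> \<partial>half_circle_measure)"
    by (subst (asm) Bochner_Integration.integral_add) (auto intro!: sub)
  then show ?thesis using Ls_eq_half_circle[OF assms, of 2] by (simp add: L_def)
qed

section \<open>Splitting the square along its diagonal\<close>

theorem theorem3p5:
  fixes k :: nat
  defines "Ps \<equiv> replicate k (\<lambda>v::nat \<Rightarrow> complex. 1 + v 0)
                 @ [\<lambda>v::nat \<Rightarrow> complex. 1 + v 0 + v 1 + v 2]"
  shows "multi_mahler 3 Ps =
           - Ls_gen (k + 3) 1 pi / pi\<^sup>2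
           + (LBINT \<theta>=0..pi. Ls 2 \<theta> * (ln (2 * sin (\<theta> / 2))) ^ k) / pi\<^sup>2 \<and>
         multi_mahler 3 Ps =
           - Ls_gen (k + 3) 1 pi / pi\<^sup>2
           - (LBINT \<theta>=0..pi. Ls (k + 1) \<theta> * ln (2 * sin (\<theta> / 2))) / pi\<^sup>2"
proof -
  let ?H = "half_circle_measure"
  define L where "L = (\<lambda>\<theta>::real. ln (2 * sin (\<theta> / 2)))"
  have [measurable]: "L \<in> borel_measurable borel" unfolding L_def by measurable
  have L_int: "integrable ?H (\<lambda>\<theta>. L \<theta> ^ m)" for m
    using integrable_ln_chord_power by (simp add: L_def)
  \<comment> \<open>Where \<omega> \<le> \<theta> the maximum belongs to \<theta> and raises the
    power to k + 1; \<open>T\<close> is the complementary region.\<close>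
  define D where "D = (\<lambda>(\<theta>, \<omega>). of_bool (\<omega> \<le> \<theta>) * L \<theta> ^ Suc k)"
  define T where "T = (\<lambda>(\<theta>, \<omega>). of_bool (\<theta> < \<omega>) * (L \<theta> ^ k * L \<omega>))"
  have D_int: "integrable (?H \<Otimes>\<^sub>M ?H) D"
    using half_circle2.integrable_product_mult[OF L_int[of "Suc k"] L_int[of 0]]
    unfolding D_def by (rule Bochner_Integration.integrable_bound) auto
  have T_int: "integrable (?H \<Otimes>\<^sub>M ?H) T"
    using half_circle2.integrable_product_mult[OF L_int[of k] L_int[of 1]]
    unfolding T_def by (rule Bochner_Integration.integrable_bound) auto
  have "multi_mahler 3 Ps
      = (\<integral>p. L (fst p) ^ k * ln (max (2 * sin (fst p / 2)) (2 * sin (snd p / 2))) \<partial>(?H \<Otimes>\<^sub>M ?H))"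
    unfolding Ps_def multi_mahler_eq_torus L_def
    by (rule integral_torus_eq_square[of "\<lambda>x y. ln x ^ k * ln (max x y)"]) measurable
  also have "\<dots> = (\<integral>p. D p + T p \<partial>(?H \<Otimes>\<^sub>M ?H))"
  proof (rule integral_cong_AE)
    let ?F = "\<lambda>p. L (fst p) ^ k * ln (max (2 * sin (fst p / 2)) (2 * sin (snd p / 2)))"
    show F: "?F \<in> borel_measurable (?H \<Otimes>\<^sub>M ?H)" by measurable
    show DT: "(\<lambda>p. D p + T p) \<in> borel_measurable (?H \<Otimes>\<^sub>M ?H)"
      using D_int T_int by simp
    have eq: "?F (\<theta>, \<omega>) = D (\<theta>, \<omega>) + T (\<theta>, \<omega>)"
      if "\<theta> \<in> {0<..pi}" "\<omega> \<in> {0<..pi}" for \<theta> \<omega>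
    proof -
      \<comment> \<open>The half-angles lie in [0, \<pi>/2], where the sine is strictly
        increasing.\<close>
      have "sin (\<omega> / 2) \<le> sin (\<theta> / 2) \<longleftrightarrow> \<omega> \<le> \<theta>"
        using that by (subst sin_mono_le_eq) auto
      then show ?thesis by (auto simp: D_def T_def L_def max_def)
    qed
    show "AE p in ?H \<Otimes>\<^sub>M ?H. ?F p = D p + T p"
    proof (rule half_circle2.AE_pair_measure)
      show "{p \<in> space (?H \<Otimes>\<^sub>M ?H). ?F p = D p + T p} \<in> sets (?H \<Otimes>\<^sub>M ?H)"
        by (rule borel_measurable_eq[OF F DT])
      show "AE \<theta> in ?H. AE \<omega> in ?H. ?F (\<theta>, \<omega>) = D (\<theta>, \<omega>) + T (\<theta>, \<omega>)"
        using AE_half_circle_measure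
      proof eventually_elim
        case (elim \<theta>)
        show ?case using AE_half_circle_measure by eventually_elim (rule eq[OF elim])
      qed
    qed
  qed
  also have "\<dots> = (\<integral>p. D p \<partial>(?H \<Otimes>\<^sub>M ?H)) + (\<integral>p. T p \<partial>(?H \<Otimes>\<^sub>M ?H))"
    by (rule Bochner_Integration.integral_add[OF D_int T_int])
  finally have main: "multi_mahler 3 Ps = (\<integral>p. D p \<partial>(?H \<Otimes>\<^sub>M ?H)) + (\<integral>p. T p \<partial>(?H \<Otimes>\<^sub>M ?H))" .

  have "(\<integral>p. D p \<partial>(?H \<Otimes>\<^sub>M ?H)) = (\<integral>\<theta>. (\<integral>\<omega>. D (\<theta>, \<omega>) \<partial>?H) \<partial>?H)"
    by (rule half_circle2.integral_fst'[OF D_int, symmetric])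
  \<comment> \<open>The inner integral is \<theta>/\<pi>: this is the linear weight of the
    generalized log-sine integral, whose exponent is k + 3 - 1 - 1 = k + 1.\<close>
  also have "\<dots> = (\<integral>\<theta>. (\<integral>\<omega>. of_bool (\<omega> \<le> \<theta>) \<partial>?H) * L \<theta> ^ Suc k \<partial>?H)"
    by (simp add: D_def)
  also have "\<dots> = (LBINT \<theta>=0..pi. \<theta> * ln \<bar>2 * sin (\<theta> / 2)\<bar> ^ Suc k / pi) / pi"
  proof (subst interval_integral_eq_half_circle[where f = "\<lambda>\<theta>. (\<integral>\<omega>. of_bool (\<omega> \<le> \<theta>) \<partial>?H) * L \<theta> ^ Suc k"])
    fix \<theta> :: real assume \<theta>: "0 \<le> \<theta>" "\<theta> \<le> pi"
    then have "0 \<le> sin (\<theta> / 2)" by (intro sin_ge_zero) auto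
    then show "(\<integral>\<omega>. of_bool (\<omega> \<le> \<theta>) \<partial>?H) * L \<theta> ^ Suc k = \<theta> * ln \<bar>2 * sin (\<theta> / 2)\<bar> ^ Suc k / pi"
      using integral_half_circle_of_bool_le[OF \<theta>] by (simp add: L_def)
  qed auto
  also have "\<dots> = - Ls_gen (k + 3) 1 pi / pi\<^sup>2"
    by (simp add: Ls_gen_def power2_eq_square)
  finally have D_eq: "(\<integral>p. D p \<partial>(?H \<Otimes>\<^sub>M ?H)) = - Ls_gen (k + 3) 1 pi / pi\<^sup>2" .

  have "(\<integral>p. T p \<partial>(?H \<Otimes>\<^sub>M ?H)) = (\<integral>\<theta>. (\<integral>\<omega>. T (\<theta>, \<omega>) \<partial>?H) \<partial>?H)"
    by (rule half_circle2.integral_fst'[OF T_int, symmetric])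
  \<comment> \<open>Integrating \<omega> first meets the tail of a single logarithm, hence
    \<open>Ls 2\<close>.\<close>
  also have "\<dots> = (\<integral>\<theta>. (\<integral>\<omega>. of_bool (\<theta> < \<omega>) * L \<omega> \<partial>?H) * L \<theta> ^ k \<partial>?H)"
    by (simp add: T_def mult.left_commute[of _ "L _ ^ k"] mult.commute[of _ "L _ ^ k"])
  also have "\<dots> = (LBINT \<theta>=0..pi. Ls 2 \<theta> * L \<theta> ^ k / pi) / pi"
  proof (subst interval_integral_eq_half_circle[where f = "\<lambda>\<theta>. (\<integral>\<omega>. of_bool (\<theta> < \<omega>) * L \<omega> \<partial>?H) * L \<theta> ^ k"])
    fix \<theta> :: real assume "0 \<le> \<theta>" "\<theta> \<le> pi"
    from integral_half_circle_ln_tail[OF this]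
    show "(\<integral>\<omega>. of_bool (\<theta> < \<omega>) * L \<omega> \<partial>?H) * L \<theta> ^ k = Ls 2 \<theta> * L \<theta> ^ k / pi"
      by (simp add: L_def)
  qed auto
  finally have T_eq1: "(\<integral>p. T p \<partial>(?H \<Otimes>\<^sub>M ?H)) = (LBINT \<theta>=0..pi. Ls 2 \<theta> * L \<theta> ^ k) / pi\<^sup>2"
    by (simp add: power2_eq_square)

  have "(\<integral>p. T p \<partial>(?H \<Otimes>\<^sub>M ?H)) = (\<integral>\<omega>. (\<integral>\<theta>. T (\<theta>, \<omega>) \<partial>?H) \<partial>?H)"
    using half_circle2.integral_snd[of "\<lambda>\<theta> \<omega>. T (\<theta>, \<omega>)"] T_int by simp
  \<comment> \<open>Integrating \<theta> first meets the head of the k-th power, which is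
    \<open>Ls (k + 1)\<close> up to the factor -1/\<pi>.\<close>
  also have "\<dots> = (\<integral>\<omega>. (\<integral>\<theta>. of_bool (\<theta> < \<omega>) * L \<theta> ^ k \<partial>?H) * L \<omega> \<partial>?H)"
    by (simp add: T_def mult.assoc[symmetric])
  also have "\<dots> = (LBINT \<omega>=0..pi. Ls (k + 1) \<omega> * L \<omega> / - pi) / pi"
  proof (subst interval_integral_eq_half_circle[where f = "\<lambda>\<omega>. (\<integral>\<theta>. of_bool (\<theta> < \<omega>) * L \<theta> ^ k \<partial>?H) * L \<omega>"])
    fix \<omega> :: real assume "0 \<le> \<omega>" "\<omega> \<le> pi"
    from Ls_eq_half_circle[OF this, of "k + 1"]
    show "(\<integral>\<theta>. of_bool (\<theta> < \<omega>) * L \<theta> ^ k \<partial>?H) * L \<omega> = Ls (k + 1) \<omega> * L \<omega> / - pi"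
      by (simp add: L_def)
  qed auto
  finally have T_eq2: "(\<integral>p. T p \<partial>(?H \<Otimes>\<^sub>M ?H)) = - (LBINT \<theta>=0..pi. Ls (k + 1) \<theta> * L \<theta>) / pi\<^sup>2"
    by (simp add: power2_eq_square interval_lebesgue_integral_uminus)

  show ?thesis
    using main D_eq T_eq1 T_eq2 by (simp add: L_def)
qed

end
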